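(* (Short-time existence.) Let $k\ge1$ and let $\phi\colon\mathbb{R}^2\to\mathbb{R}^{1+2}$ be an evolution by isothermal gauge for $C^k\times C^{k-1}$ initial data $(\mathcal{C},V)$, and let $U_0$ denote the unit tangent vector along $\mathcal{C}$. Suppose $V=(1,v)$ is uniformly timelike, i.e. $\sup_{s\in\mathbb{R}}|v(s)|<1$, and suppose $U_0$ is uniformly continuous. Then there exists $T>0$, depending only on $\sup_{s\in\mathbb{R}}\frac{1}{1-|v(s)|}$ and the modulus of continuity of $U_0$, such that $\mathrm{Im}(\phi)\cap\{(x^0,x^1,x^2)\colon|x^0|\le T\}$ is a $C^k$ immersed timelike maximal surface containing $\mathrm{Im}(\mathcal{C})$ and tangent to $V$ along $\mathcal{C}$.
   Context: $\mathbb{R}^{1+2}$ is $\mathbb{R}^3$ with coordinates $(x^0,x^1,x^2)$ and the Minkowski metric $\eta=-(dx^0)^2+(dx^1)^2+(dx^2)^2$. A $C^1$ immersion $\phi$ with induced form $g=\phi^*\eta$ is timelike if $\det g<0$ everywhere, and maximal if $\frac{1}{\sqrt{|\det g|}}\partial_i\big(\sqrt{|\det g|}\,g^{ij}\partial_j\phi^\alpha\big)=0$ ($\alpha=0,1,2$) holds in the weak sense. Initial data and evolution: $\mathcal{C}(s)=(0,c(s))$ and $V(s)=(1,v(s))$, where $c\colon\mathbb{R}\to\mathbb{R}^2$ is a $C^k$ immersion, $v\colon\mathbb{R}\to\mathbb{R}^2$ is $C^{k-1}$, and $\langle\dot c(s),v(s)\rangle=0$, $|\dot c(s)|^2+|v(s)|^2=1$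 for all $s$. The evolution by isothermal gauge is $\phi(s,t)=(t,\gamma(s,t))$ with $$\gamma(s,t)=\tfrac12\Big(c(s+t)+c(s-t)+\int_{s-t}^{s+t}v(\zeta)\,d\zeta\Big).$$ $U_0(s)=\dot c(s)/|\dot c(s)|$, as a function of the parameter $s$. The set $\mathrm{Im}(\phi)\cap\{|x^0|\le T\}$ is the image under $\phi$ of $\mathbb{R}\times[-T,T]$; the surface is understood to be parametrised by $\phi$ on this strip. *)

theory Defs
  imports "HOL-Analysis.Analysis"
begin

section \<open>Differentiability classes and immersions\<close>

text \<open>\<open>Ck_open n W f\<close>: \<open>f\<close> is of class \<open>C\<^sup>n\<close> on the open set \<open>W\<close>; all iterated directional
  derivatives of order at most \<open>n\<close> exist as total derivatives applied to a vector and are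
  continuous. It is only meant for open \<open>W\<close>, since the derivatives are not relative to \<open>W\<close>.\<close>

primrec Ck_open :: "nat \<Rightarrow> 'a::euclidean_space set \<Rightarrow> ('a \<Rightarrow> 'b::real_normed_vector) \<Rightarrow> bool" where
  "Ck_open 0 W f \<longleftrightarrow> continuous_on W f"
| "Ck_open (Suc n) W f \<longleftrightarrow>
     (\<forall>p\<in>W. f differentiable (at p)) \<and>
     (\<forall>u. Ck_open n W (\<lambda>p. frechet_derivative f (at p) u))"

text \<open>On a set that need not be open (such as a closed strip), class \<open>C\<^sup>k\<close> means class \<open>C\<^sup>k\<close> on
  an open neighbourhood. The rank condition is imposed at all points of the set, boundary points
  included.\<close>

definition Ck_immersion_on :: "nat \<Rightarrow> 'a::euclidean_space set \<Rightarrow> ('a \<Rightarrow> 'b::real_normed_vector) \<Rightarrow> bool"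
  where "Ck_immersion_on k S f \<longleftrightarrow>
    (\<exists>W. open W \<and> S \<subseteq> W \<and> Ck_open k W f) \<and>
    (\<forall>p\<in>S. inj (frechet_derivative f (at p)))"

definition tangent_plane :: "(real^2 \<Rightarrow> real^3) \<Rightarrow> real^2 \<Rightarrow> (real^3) set"
  where "tangent_plane \<phi> p = range (frechet_derivative \<phi> (at p))"


section \<open>Timelike maximal surfaces in Minkowski space\<close>

text \<open>The coordinates \<open>(x\<^sup>0, x\<^sup>1, x\<^sup>2)\<close> of Minkowski space are the components \<open>x $ 1\<close>, \<open>x $ 2\<close>,
  \<open>x $ 3\<close> of a vector in \<open>real^3\<close>.\<close>

definition minkowski :: "real^3 \<Rightarrow> real^3 \<Rightarrow> real"
  where "minkowski x y = - (x $ 1) * (y $ 1) + (x $ 2) * (y $ 2) + (x $ 3) * (y $ 3)"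

definition spacetime :: "real \<Rightarrow> real^2 \<Rightarrow> real^3"
  where "spacetime t x = vector [t, x $ 1, x $ 2]"

definition partial_deriv :: "2 \<Rightarrow> (real^2 \<Rightarrow> 'b::real_normed_vector) \<Rightarrow> real^2 \<Rightarrow> 'b"
  where "partial_deriv i f p = frechet_derivative f (at p) (axis i 1)"

definition induced_form :: "(real^2 \<Rightarrow> real^3) \<Rightarrow> real^2 \<Rightarrow> real^2^2"
  where "induced_form \<phi> p =
    (\<chi> i j. minkowski (partial_deriv i \<phi> p) (partial_deriv j \<phi> p))"

definition timelike_on :: "(real^2) set \<Rightarrow> (real^2 \<Rightarrow> real^3) \<Rightarrow> bool"
  where "timelike_on S \<phi> \<longleftrightarrow> (\<forall>p\<in>S. det (induced_form \<phi> p) < 0)"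

definition test_function_on :: "(real^2) set \<Rightarrow> (real^2 \<Rightarrow> real) \<Rightarrow> bool"
  where "test_function_on W \<psi> \<longleftrightarrow>
    (\<forall>n. Ck_open n UNIV \<psi>) \<and> compact (closure {p. \<psi> p \<noteq> 0}) \<and> closure {p. \<psi> p \<noteq> 0} \<subseteq> W"

text \<open>The weak form of \<open>\<partial>\<^sub>i (\<surd>\<bar>det g\<bar> g\<^sup>i\<^sup>j \<partial>\<^sub>j \<phi>\<^sup>\<alpha>) = 0\<close> in the interior of the parameter domain.
  The prefactor \<open>1/\<surd>\<bar>det g\<bar>\<close> of the strong form cancels against the area element
  \<open>\<surd>\<bar>det g\<bar> ds dt\<close>. For a timelike \<open>C\<^sup>1\<close> immersion the integrand is continuous with compact
  support in the interior, so the integral exists.\<close>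

definition weakly_maximal_on :: "(real^2) set \<Rightarrow> (real^2 \<Rightarrow> real^3) \<Rightarrow> bool"
  where "weakly_maximal_on S \<phi> \<longleftrightarrow>
    (\<forall>\<psi> \<alpha>. test_function_on (interior S) \<psi> \<longrightarrow>
      (LINT p:interior S|lborel.
        (\<Sum>i\<in>UNIV. \<Sum>j\<in>UNIV.
           sqrt \<bar>det (induced_form \<phi> p)\<bar> * matrix_inv (induced_form \<phi> p) $ i $ j *
           partial_deriv j (\<lambda>q. \<phi> q $ \<alpha>) p * partial_deriv i \<psi> p)) = 0)"


section \<open>Initial data and evolution by isothermal gauge\<close>

definition initial_data :: "nat \<Rightarrow> (real \<Rightarrow> real^2) \<Rightarrow> (real \<Rightarrow> real^2) \<Rightarrow> bool"
  where "initial_data k c v \<longleftrightarrow>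
    Ck_immersion_on k UNIV c \<and> Ck_open (k - 1) UNIV v \<and>
    (\<forall>s. vector_derivative c (at s) \<bullet> v s = 0 \<and>
         (norm (vector_derivative c (at s)))\<^sup>2 + (norm (v s))\<^sup>2 = 1)"

definition initial_curve :: "(real \<Rightarrow> real^2) \<Rightarrow> real \<Rightarrow> real^3"
  where "initial_curve c s = spacetime 0 (c s)"

definition initial_velocity :: "(real \<Rightarrow> real^2) \<Rightarrow> real \<Rightarrow> real^3"
  where "initial_velocity v s = spacetime 1 (v s)"

definition unit_tangent :: "(real \<Rightarrow> real^2) \<Rightarrow> real \<Rightarrow> real^2"
  where "unit_tangent c s =
    vector_derivative c (at s) /\<^sub>R norm (vector_derivative c (at s))"

text \<open>The integral is oriented, so negative \<open>t\<close> is covered.\<close>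

definition isothermal_curve :: "(real \<Rightarrow> real^2) \<Rightarrow> (real \<Rightarrow> real^2) \<Rightarrow> real \<Rightarrow> real \<Rightarrow> real^2"
  where "isothermal_curve c v s t =
    (1/2) *\<^sub>R (c (s + t) + c (s - t) + (LBINT \<zeta>=ereal (s - t)..ereal (s + t). v \<zeta>))"

text \<open>A parameter \<open>p\<close> is \<open>(s, t) = (p $ 1, p $ 2)\<close>.\<close>

definition isothermal_evolution :: "(real \<Rightarrow> real^2) \<Rightarrow> (real \<Rightarrow> real^2) \<Rightarrow> real^2 \<Rightarrow> real^3"
  where "isothermal_evolution c v p = spacetime (p $ 2) (isothermal_curve c v (p $ 1) (p $ 2))"

definition modulus_of_continuity :: "('a::metric_space \<Rightarrow> 'b::metric_space) \<Rightarrow> real \<Rightarrow> ennreal"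
  where "modulus_of_continuity f \<delta> =
    (SUP (x, y) \<in> {(x, y). dist x y \<le> \<delta>}. ennreal (dist (f x) (f y)))"

end

theory Submission
  imports Defs
begin

text \<open>By d'Alembert, \<open>\<phi>(s, t) = (t, F(s + t) + G(s - t))\<close> with \<open>F' = A = (c' + v)/2\<close> and
  \<open>G' = B = (c' - v)/2\<close>, and the gauge conditions say \<open>\<bar>A\<bar> = \<bar>B\<bar> = 1/2\<close>. The induced metric is
  therefore \<open>\<bar>\<gamma>\<^sub>s\<bar>\<^sup>2 (ds\<^sup>2 - dt\<^sup>2)\<close> with \<open>\<gamma>\<^sub>s = A(s + t) + B(s - t)\<close>. As it is conformally flat,
  \<open>\<surd>\<bar>det g\<bar> g\<^sup>i\<^sup>j\<close> is constant wherever \<open>\<gamma>\<^sub>s \<noteq> 0\<close>, and the maximal surface equation is the linear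
  wave equation. It remains to see that \<open>\<gamma>\<^sub>s\<close> does not vanish for small \<open>t\<close>. At \<open>t = 0\<close> it equals
  \<open>c'\<close>, and \<open>\<bar>c'\<bar> \<ge> 1/M\<close>; the normal component \<open>v\<close> cannot compensate this as long as the tangent
  direction turns by less than \<open>1/M\<close> between \<open>s - t\<close> and \<open>s + t\<close>.\<close>

section \<open>Functions of class \<open>C\<^sup>k\<close> and weak derivatives\<close>

lemma Ck_open_imp_continuous_on:
  "Ck_open n W f \<Longrightarrow> continuous_on W f"
  by (cases n) (auto intro!: differentiable_imp_continuous_on differentiable_at_imp_differentiable_on)

lemma Ck_open_const: "Ck_open n W (\<lambda>p. c)"
  by (induction n arbitrary: c) auto

lemma Ck_open_bounded_linear:
  assumes "bounded_linear L"
  shows "Ck_open n W L"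
proof (cases n)
  case 0
  then show ?thesis using assms by (simp add: linear_continuous_on)
next
  case (Suc m)
  have L: "(L has_derivative L) (at p)" for p
    using assms by (rule bounded_linear_imp_has_derivative)
  have "frechet_derivative L (at p) = L" for p
    using frechet_derivative_at[OF L] by simp
  with L show ?thesis
    by (auto simp: Suc differentiable_def Ck_open_const)
qed

lemma Ck_open_add:
  assumes "Ck_open n UNIV f" "Ck_open n UNIV g"
  shows "Ck_open n UNIV (\<lambda>p. f p + g p)"
  using assms
proof (induction n arbitrary: f g)
  case (Suc n)
  have "frechet_derivative (\<lambda>p. f p + g p) (at p)
      = (\<lambda>u. frechet_derivative f (at p) u + frechet_derivative g (at p) u)" for p
    using Suc.prems
    by (intro frechet_derivative_at[symmetric] has_derivative_add)
      (simp_all add: frechet_derivative_works[symmetric])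
  with Suc show ?case by auto
qed (auto intro: continuous_intros)

lemma Ck_open_bounded_linear_left:
  assumes "bounded_linear L" "Ck_open n UNIV f"
  shows "Ck_open n UNIV (\<lambda>p. L (f p))"
  using assms(2)
proof (induction n arbitrary: f)
  case 0
  then show ?case
    using bounded_linear.continuous_on[OF assms(1)] by simp
next
  case (Suc n)
  have D: "((\<lambda>p. L (f p)) has_derivative (\<lambda>u. L (frechet_derivative f (at p) u))) (at p)" for p
    using Suc.prems
    by (intro bounded_linear.has_derivative[OF assms(1)]) (simp add: frechet_derivative_works[symmetric])
  have "frechet_derivative (\<lambda>p. L (f p)) (at p) = (\<lambda>u. L (frechet_derivative f (at p) u))" for p
    using frechet_derivative_at[OF D] by simp
  with Suc D show ?case by (auto simp: differentiable_def)
qed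

lemma Ck_open_bounded_linear_right:
  assumes "bounded_linear L" "Ck_open n UNIV f"
  shows "Ck_open n UNIV (\<lambda>p. f (L p))"
  using assms(2)
proof (induction n arbitrary: f)
  case 0
  then show ?case
    using linear_continuous_on[OF assms(1), of UNIV]
    by (auto intro: continuous_on_compose2)
next
  case (Suc n)
  have D: "((\<lambda>p. f (L p)) has_derivative (\<lambda>u. frechet_derivative f (at (L p)) (L u))) (at p)" for p
    using Suc.prems
    by (intro has_derivative_compose[OF bounded_linear_imp_has_derivative[OF assms(1)]])
      (simp add: frechet_derivative_works[symmetric])
  have "frechet_derivative (\<lambda>p. f (L p)) (at p) = (\<lambda>u. frechet_derivative f (at (L p)) (L u))" for p
    using frechet_derivative_at[OF D] by simp
  moreover have "Ck_open n UNIV (\<lambda>p. frechet_derivative f (at (L p)) (L u))" for u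
    using Suc.IH[of "\<lambda>x. frechet_derivative f (at x) (L u)"] Suc.prems by simp
  ultimately show ?case using D by (auto simp: differentiable_def)
qed

text \<open>Integration gains one derivative. This is what makes the evolution as regular as
  \<open>c\<close>, although \<open>v\<close> has one derivative less.\<close>

lemma Ck_open_antiderivative:
  fixes F :: "real \<Rightarrow> 'a::real_normed_vector"
  assumes "\<And>x. (F has_vector_derivative f x) (at x)" "Ck_open n UNIV f"
  shows "Ck_open (Suc n) UNIV F"
proof -
  have D: "(F has_derivative (\<lambda>u. u *\<^sub>R f x)) (at x)" for x
    using assms(1) by (simp add: has_vector_derivative_def)
  have "frechet_derivative F (at x) = (\<lambda>u. u *\<^sub>R f x)" for x
    using frechet_derivative_at[OF D] by simp
  with D show ?thesis
    by (auto simp: differentiable_def intro!: Ck_open_bounded_linear_left[OF bounded_linear_scaleR_right] assms(2))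
qed

section \<open>Compact supports, translations and weak derivatives\<close>

lemma frechet_derivative_outside_support:
  assumes "p \<notin> closure {p. f p \<noteq> 0}"
  shows "frechet_derivative f (at p) = (\<lambda>u. 0)"
proof -
  have "(f has_derivative (\<lambda>u. 0)) (at p)"
  proof (rule has_derivative_transform_within_open)
    show "((\<lambda>_. 0) has_derivative (\<lambda>u. 0)) (at p)" by simp
    show "open (- closure {p. f p \<noteq> 0})" by (simp add: open_Compl)
    show "0 = f x" if "x \<in> - closure {p. f p \<noteq> 0}" for x
      using that closure_subset[of "{p. f p \<noteq> 0}"] by auto
  qed (use assms in simp)
  then show ?thesis by (metis frechet_derivative_at)
qed

lemma integrable_compact_support:
  fixes f :: "'a::euclidean_space \<Rightarrow> 'b::{banach, second_countable_topology}"
  assumes "continuous_on UNIV f" "compact K" "\<And>x. x \<notin> K \<Longrightarrow> f x = 0"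
  shows "integrable lborel f"
proof -
  have "integrable lborel (\<lambda>x. indicator K x *\<^sub>R f x)"
    using assms(1,2) by (intro borel_integrable_compact) (auto intro: continuous_on_subset)
  also have "(\<lambda>x. indicator K x *\<^sub>R f x) = f"
    using assms(3) by (auto simp: indicator_def fun_eq_iff)
  finally show ?thesis .
qed

lemma lborel_integral_translate:
  fixes f :: "'a::euclidean_space \<Rightarrow> 'b::{banach, second_countable_topology}"
  assumes "f \<in> borel_measurable borel"
  shows "(LINT x|lborel. f (x + a)) = (LINT x|lborel. f x)"
proof -
  have "(LINT x|lborel. f x) = (LINT x|distr lborel borel ((+) a). f x)"
    by (simp add: lborel_distr_plus)
  also have "\<dots> = (LINT x|lborel. f (a + x))"
    using assms by (intro integral_distr) auto
  finally show ?thesis by (simp add: add.commute)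
qed

text \<open>Translation by \<open>r u\<close> preserves both \<open>h\<close> and Lebesgue measure, so \<open>\<integral> h(p) \<psi>(p + r u) dp\<close>
  does not depend on \<open>r\<close>; differentiating at \<open>r = 0\<close> gives the claim.\<close>

lemma integral_directional_derivative_eq_0:
  fixes \<psi> h :: "'a::euclidean_space \<Rightarrow> real"
  assumes \<psi>: "Ck_open 1 UNIV \<psi>" and K: "compact (closure {p. \<psi> p \<noteq> 0})"
    and h: "continuous_on UNIV h" and inv: "\<And>p r. h (p + r *\<^sub>R u) = h p"
  shows "integrable lborel (\<lambda>p. h p * frechet_derivative \<psi> (at p) u)" (is ?int)
    and "(LINT p|lborel. h p * frechet_derivative \<psi> (at p) u) = 0" (is ?zero)
proof -
  define K where "K = closure {p. \<psi> p \<noteq> 0}"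
  define D where "D p = frechet_derivative \<psi> (at p) u" for p
  have cK: "compact K" using K by (simp add: K_def)
  have \<psi>0: "p \<in> K" if "\<psi> p \<noteq> 0" for p
    using that closure_subset[of "{p. \<psi> p \<noteq> 0}"] by (auto simp: K_def)
  have D0: "D p = 0" if "p \<notin> K" for p
    using frechet_derivative_outside_support[of p \<psi>] that by (simp add: K_def D_def)
  have c\<psi>: "continuous_on UNIV \<psi>" using \<psi> by (rule Ck_open_imp_continuous_on)
  have cD: "continuous_on UNIV D" using \<psi> by (simp add: D_def)
  show ?int
    unfolding D_def[symmetric]
    by (rule integrable_compact_support[OF _ cK]) (use D0 cD h in \<open>auto intro: continuous_intros\<close>)
  have "(\<psi> has_derivative frechet_derivative \<psi> (at p)) (at p)" for p
    using \<psi> by (simp add: frechet_derivative_works[symmetric])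
  note d\<psi> = this
  have line: "((\<lambda>r. \<psi> (p + r *\<^sub>R u)) has_real_derivative D (p + r *\<^sub>R u)) (at r)" for p r
  proof -
    have "((\<lambda>r. \<psi> (p + r *\<^sub>R u)) has_derivative
        (\<lambda>x. frechet_derivative \<psi> (at (p + r *\<^sub>R u)) (x *\<^sub>R u))) (at r)"
      by (rule has_derivative_compose[OF _ d\<psi>]) (auto intro!: derivative_eq_intros)
    moreover have "frechet_derivative \<psi> (at (p + r *\<^sub>R u)) (x *\<^sub>R u) = D (p + r *\<^sub>R u) * x" for x
      using linear_cmul[OF has_derivative_linear[OF d\<psi>]] by (simp add: D_def)
    ultimately show ?thesis
      by (simp add: has_field_derivative_def)
  qed
  have "bounded (D ` K)"
    using cK cD by (intro compact_imp_bounded compact_continuous_image) (auto intro: continuous_on_subset)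
  then obtain B where B: "B > 0" "\<And>p. p \<in> K \<Longrightarrow> \<bar>D p\<bar> \<le> B"
    unfolding bounded_pos by auto
  have DB: "\<bar>D p\<bar> \<le> B" for p
    using B D0[of p] by (cases "p \<in> K") auto
  \<comment> \<open>One compact set containing the supports of all translates of
    \<open>\<psi>\<close> by \<open>r u\<close> with r in [0,1], so that a single integrable
    function dominates all difference quotients.\<close>
  define K' where "K' = (\<lambda>(r, x). x - r *\<^sub>R u) ` ({0..1} \<times> K)"
  have cK': "compact K'"
    unfolding K'_def
    by (intro compact_continuous_image compact_Times cK)
      (auto simp: case_prod_unfold intro!: continuous_intros)
  have "bounded (h ` K')"
    using cK' h by (intro compact_imp_bounded compact_continuous_image) (auto intro: continuous_on_subset)
  then obtain H where H: "H > 0" "\<And>p. p \<in> K' \<Longrightarrow> \<bar>h p\<bar> \<le> H"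
    unfolding bounded_pos by auto
  have K'I: "p \<in> K'" if "p + r *\<^sub>R u \<in> K" "0 \<le> r" "r \<le> 1" for p r
    unfolding K'_def using that by (intro image_eqI[of _ _ "(r, p + r *\<^sub>R u)"]) auto
  define q where "q n p = h p * ((\<psi> (p + inverse (Suc n) *\<^sub>R u) - \<psi> p) / inverse (Suc n))" for n :: nat and p
  have r: "0 < inverse (real (Suc n))" "inverse (real (Suc n)) \<le> 1" for n
    by (auto simp: field_simps)
  \<comment> \<open>The mean value theorem along the line through \<open>p\<close> in direction
    \<open>u\<close> bounds the quotient independently of \<open>r\<close>.\<close>
  have lip: "\<bar>(\<psi> (p + r *\<^sub>R u) - \<psi> p) / r\<bar> \<le> B" if "r > 0" for p r
  proof -
    obtain z where "\<psi> (p + r *\<^sub>R u) - \<psi> (p + 0 *\<^sub>R u) = (r - 0) * D (p + z *\<^sub>R u)"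
      using MVT2[of 0 r "\<lambda>r. \<psi> (p + r *\<^sub>R u)" "\<lambda>r. D (p + r *\<^sub>R u)"] line \<open>r > 0\<close> by blast
    with that DB show ?thesis by simp
  qed
  have bound: "\<bar>q n p\<bar> \<le> indicator K' p * (H * B)" for n p
  proof (cases "p \<in> K'")
    case True
    have "\<bar>q n p\<bar> \<le> H * B"
      unfolding q_def abs_mult
      by (intro mult_mono H(2) True lip r) (use H(1) in auto)
    with True show ?thesis by simp
  next
    case False
    then have "\<psi> (p + inverse (Suc n) *\<^sub>R u) = 0" "\<psi> p = 0"
      using K'I[of p "inverse (Suc n)"] K'I[of p 0] \<psi>0 r[of n] by fastforce+
    with False show ?thesis by (simp add: q_def)
  qed
  \<comment> \<open>Since \<open>h\<close> is invariant under the shift, the two terms of the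
    difference quotient have the same integral against \<open>h\<close>.\<close>
  have qint0: "(LINT p|lborel. q n p) = 0" for n
  proof -
    let ?r = "inverse (real (Suc n))"
    have "(\<lambda>p. h p * \<psi> p) \<in> borel_measurable borel"
      by (intro borel_measurable_continuous_onI continuous_intros h c\<psi>)
    then have "(LINT p|lborel. h (p + ?r *\<^sub>R u) * \<psi> (p + ?r *\<^sub>R u)) = (LINT p|lborel. h p * \<psi> p)"
      by (rule lborel_integral_translate)
    then have e: "(LINT p|lborel. h p * \<psi> (p + ?r *\<^sub>R u)) = (LINT p|lborel. h p * \<psi> p)"
      by (simp only: inv)
    have i1: "integrable lborel (\<lambda>p. h p * \<psi> p)"
      by (rule integrable_compact_support[OF _ cK]) (use \<psi>0 c\<psi> h in \<open>auto intro: continuous_intros\<close>)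
    have i2: "integrable lborel (\<lambda>p. h p * \<psi> (p + ?r *\<^sub>R u))"
    proof (rule integrable_compact_support[OF _ cK'])
      show "continuous_on UNIV (\<lambda>p. h p * \<psi> (p + ?r *\<^sub>R u))"
        by (intro continuous_intros h continuous_on_compose2[OF c\<psi>]) auto
      show "h p * \<psi> (p + ?r *\<^sub>R u) = 0" if "p \<notin> K'" for p
        using that K'I[of p ?r] \<psi>0 r[of n] by fastforce
    qed
    have "q n = (\<lambda>p. (h p * \<psi> (p + ?r *\<^sub>R u) - h p * \<psi> p) / ?r)"
      by (simp add: q_def fun_eq_iff algebra_simps)
    then show ?thesis
      using i1 i2 e by (simp del: of_nat_Suc)
  qed
  have "(\<lambda>n. LINT p|lborel. q n p) \<longlonglongrightarrow> (LINT p|lborel. h p * D p)"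
  proof (rule integral_dominated_convergence)
    show "(\<lambda>p. h p * D p) \<in> borel_measurable lborel"
      using h cD by (auto intro!: borel_measurable_continuous_onI continuous_intros)
    show "q n \<in> borel_measurable lborel" for n
    proof -
      have "continuous_on UNIV (q n)"
        unfolding q_def by (intro continuous_intros h c\<psi> continuous_on_compose2[OF c\<psi>]) auto
      then show ?thesis
        by (simp add: borel_measurable_continuous_onI)
    qed
    show "integrable lborel (\<lambda>p. indicator K' p * (H * B))"
      using borel_integrable_compact[OF cK', of "\<lambda>_. H * B"] by simp
    show "AE p in lborel. (\<lambda>n. q n p) \<longlonglongrightarrow> h p * D p"
    proof (rule AE_I2)
      fix p
      have "((\<lambda>r. (\<psi> (p + r *\<^sub>R u) - \<psi> p) / r) \<longlongrightarrow> D p) (at 0)"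
        using line[of p 0] by (simp add: has_field_derivative_iff)
      moreover have "filterlim (\<lambda>n. inverse (real (Suc n))) (at 0) sequentially"
        unfolding filterlim_at using LIMSEQ_inverse_real_of_nat by auto
      ultimately have "(\<lambda>n. (\<psi> (p + inverse (real (Suc n)) *\<^sub>R u) - \<psi> p) / inverse (real (Suc n))) \<longlonglongrightarrow> D p"
        by (rule filterlim_compose)
      then show "(\<lambda>n. q n p) \<longlonglongrightarrow> h p * D p"
        unfolding q_def by (rule tendsto_mult_left)
    qed
    show "AE p in lborel. norm (q n p) \<le> indicator K' p * (H * B)" for n
      using bound by simp
  qed
  then have "(\<lambda>n. 0::real) \<longlonglongrightarrow> (LINT p|lborel. h p * D p)"
    by (simp only: qint0)
  from LIMSEQ_unique[OF this tendsto_const] show ?zero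
    by (simp add: D_def)
qed

section \<open>Minkowski space\<close>

text \<open>\<open>matrix_inv\<close> is a choice among two-sided inverses. A right inverse of a
  square matrix is also a left inverse, so a witness exists, and associativity makes it
  unique.\<close>

lemma matrix_inv_eqI:
  fixes A :: "'a::field^'n^'n"
  assumes "A ** B = mat 1"
  shows "matrix_inv A = B"
proof -
  have BA: "B ** A = mat 1"
    using assms by (simp add: matrix_left_right_inverse)
  have "A ** matrix_inv A = mat 1 \<and> matrix_inv A ** A = mat 1"
    unfolding matrix_inv_def by (rule someI[of _ B]) (simp add: assms BA)
  then have "B ** (A ** matrix_inv A) = B"
    by simp
  then show ?thesis
    by (simp add: matrix_mul_assoc BA)
qed

lemma spacetime_nth [simp]:
  "spacetime t x $ 1 = t" "spacetime t x $ 2 = x $ 1" "spacetime t x $ 3 = x $ 2"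
  by (simp_all add: spacetime_def)

lemma spacetime_eq_iff [simp]: "spacetime t x = spacetime u y \<longleftrightarrow> t = u \<and> x = y"
  by (auto simp: vec_eq_iff forall_3 forall_2)

lemma spacetime_add: "spacetime t x + spacetime u y = spacetime (t + u) (x + y)"
  by (simp add: vec_eq_iff forall_3)

lemma spacetime_scaleR: "r *\<^sub>R spacetime t x = spacetime (r * t) (r *\<^sub>R x)"
  by (simp add: vec_eq_iff forall_3)

lemma spacetime_eq_0_iff [simp]: "spacetime t x = 0 \<longleftrightarrow> t = 0 \<and> x = 0"
  by (auto simp: vec_eq_iff forall_3 forall_2)

lemma bounded_linear_spacetime: "bounded_linear (\<lambda>x. spacetime 0 x)"
  by (intro linear_conv_bounded_linear[THEN iffD1] linearI)
    (simp_all add: spacetime_add spacetime_scaleR)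

lemma minkowski_spacetime: "minkowski (spacetime t x) (spacetime u y) = x \<bullet> y - t * u"
  by (simp add: minkowski_def inner_vec_def sum_2)

text \<open>In dimension two the area density scales like \<open>q\<close> and the inverse metric
  like \<open>1/q\<close>, so the conformal factor cancels and the coefficients of the flat wave
  operator remain.\<close>

lemma conformal_densitised_inverse:
  fixes g :: "real^2^2"
  assumes "q > 0" "g $ 1 $ 1 = q" "g $ 2 $ 2 = - q" "g $ 1 $ 2 = 0" "g $ 2 $ 1 = 0"
  shows "sqrt \<bar>det g\<bar> * matrix_inv g $ i $ j = (if i = j then if i = 1 then 1 else - 1 else 0)"
proof -
  define h :: "real^2^2" where "h = (\<chi> i j. if i = j then if i = 1 then 1 / q else - 1 / q else 0)"
  have "g ** h = mat 1"
    using assms by (simp add: h_def vec_eq_iff forall_2 matrix_matrix_mult_def sum_2 mat_def)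
  then have inv: "matrix_inv g = h"
    by (rule matrix_inv_eqI)
  have "sqrt \<bar>det g\<bar> = q"
    using assms by (simp add: det_2 abs_mult)
  with inv \<open>q > 0\<close> show ?thesis
    by (simp add: h_def)
qed

section \<open>The evolution of isothermal data\<close>

text \<open>Writing k as \<open>Suc n\<close> absorbs the condition that k is at least 1 and turns
  the class of \<open>v\<close> into C^n.\<close>

locale isothermal_data =
  fixes n :: nat and c v :: "real \<Rightarrow> real^2"
  assumes data: "initial_data (Suc n) c v"
begin

abbreviation c' :: "real \<Rightarrow> real^2" where "c' x \<equiv> vector_derivative c (at x)"

abbreviation \<phi> :: "real^2 \<Rightarrow> real^3" where "\<phi> \<equiv> isothermal_evolution c v"

definition A :: "real \<Rightarrow> real^2" where "A x = (1/2) *\<^sub>R (c' x + v x)"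

definition B :: "real \<Rightarrow> real^2" where "B x = (1/2) *\<^sub>R (c' x - v x)"

definition \<gamma>_s :: "real^2 \<Rightarrow> real^2" where "\<gamma>_s p = A (p $ 1 + p $ 2) + B (p $ 1 - p $ 2)"

definition \<gamma>_t :: "real^2 \<Rightarrow> real^2" where "\<gamma>_t p = A (p $ 1 + p $ 2) - B (p $ 1 - p $ 2)"

lemma Ck_c: "Ck_open (Suc n) UNIV c" and Ck_v: "Ck_open n UNIV v"
  using data unfolding initial_data_def Ck_immersion_on_def
  by (auto simp del: Ck_open.simps simp: top.extremum_unique)

lemma orthogonal: "c' x \<bullet> v x = 0"
  and normalised: "(norm (c' x))\<^sup>2 + (norm (v x))\<^sup>2 = 1"
  using data unfolding initial_data_def by auto

lemma norm_le_1: "norm (c' x) \<le> 1" "norm (v x) \<le> 1"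
proof -
  have "(norm (c' x))\<^sup>2 \<le> 1\<^sup>2" "(norm (v x))\<^sup>2 \<le> 1\<^sup>2"
    using normalised[of x] zero_le_power2[of "norm (c' x)"] zero_le_power2[of "norm (v x)"]
    unfolding one_power2 by linarith+
  then show "norm (c' x) \<le> 1" "norm (v x) \<le> 1"
    using power2_le_imp_le zero_le_one by blast+
qed

lemma c_has_vector_derivative: "(c has_vector_derivative c' x) (at x)"
  using Ck_c by (auto simp: vector_derivative_works[symmetric])

lemma Ck_c': "Ck_open n UNIV c'"
proof -
  have "frechet_derivative c (at x) 1 = c' x" for x
    using fun_cong[OF frechet_derivative_at[OF c_has_vector_derivative[unfolded has_vector_derivative_def]], of 1 x]
    by simp
  then have "(\<lambda>x. frechet_derivative c (at x) 1) = c'"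
    by (rule ext)
  moreover have "Ck_open n UNIV (\<lambda>x. frechet_derivative c (at x) 1)"
    using Ck_c by simp
  ultimately show ?thesis
    by simp
qed

lemma Ck_A: "Ck_open n UNIV A" and Ck_B: "Ck_open n UNIV B"
proof -
  note scale = Ck_open_bounded_linear_left[OF bounded_linear_scaleR_right]
  show "Ck_open n UNIV A"
    unfolding A_def[abs_def] by (intro scale Ck_open_add Ck_c' Ck_v)
  have "Ck_open n UNIV (\<lambda>x. (1/2) *\<^sub>R (c' x + (-1) *\<^sub>R v x))"
    by (intro scale Ck_open_add Ck_c' Ck_v)
  moreover have "(\<lambda>x. (1/2) *\<^sub>R (c' x + (-1) *\<^sub>R v x)) = B"
    by (simp add: fun_eq_iff B_def)
  ultimately show "Ck_open n UNIV B"
    by simp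
qed

text \<open>By orthogonality the cross term drops out of the square of c' + v and of c' - v, and the
  normalisation makes both squares equal to 1.\<close>

lemma norm_AB: "A x \<bullet> A x = 1/4" "B x \<bullet> B x = 1/4"
proof -
  have "v x \<bullet> c' x = 0"
    using orthogonal by (simp add: inner_commute)
  then show "A x \<bullet> A x = 1/4" "B x \<bullet> B x = 1/4"
    using normalised[of x] orthogonal[of x]
    by (auto simp: A_def B_def inner_add_left inner_add_right inner_diff_left inner_diff_right
        power2_norm_eq_inner)
qed

text \<open>An antiderivative \<open>V\<close> of \<open>v\<close> turns the oriented integral into
  V(s+t) - V(s-t), for either sign of t. Grouping by argument gives F = (c + V)/2 and G = (c -
  V)/2.\<close>

lemma dalembert_form:
  "\<exists>F G. (\<forall>x. (F has_vector_derivative A x) (at x)) \<and> (\<forall>x. (G has_vector_derivative B x) (at x)) \<and>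
    (\<forall>p. \<phi> p = spacetime (p $ 2) (F (p $ 1 + p $ 2) + G (p $ 1 - p $ 2)))"
proof -
  have cv: "continuous_on S v" for S
    using Ck_open_imp_continuous_on[OF Ck_v] by (rule continuous_on_subset) simp
  have "isCont v x" for x
    using cv[of UNIV] by (simp add: continuous_on_eq_continuous_at)
  then have "\<exists>V. \<forall>x::real. -\<infinity> < ereal x \<longrightarrow> ereal x < \<infinity> \<longrightarrow> (V has_vector_derivative v x) (at x)"
    by (intro einterval_antiderivative) auto
  then obtain V where V: "\<And>x. (V has_vector_derivative v x) (at x)"
    by auto
  have int: "(LBINT \<zeta>=ereal a..ereal b. v \<zeta>) = V b - V a" for a b
    by (rule interval_integral_FTC_finite[OF cv has_vector_derivative_at_within[OF V]])
  define F where "F x = (1/2) *\<^sub>R (c x + V x)" for x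
  define G where "G x = (1/2) *\<^sub>R (c x - V x)" for x
  note half = bounded_linear.has_vector_derivative[OF bounded_linear_scaleR_right]
  have "(F has_vector_derivative A x) (at x)" "(G has_vector_derivative B x) (at x)" for x
    unfolding F_def[abs_def] G_def[abs_def] A_def B_def
    by (rule half has_vector_derivative_add has_vector_derivative_diff c_has_vector_derivative V)+
  moreover have "\<phi> p = spacetime (p $ 2) (F (p $ 1 + p $ 2) + G (p $ 1 - p $ 2))" for p
    by (simp add: isothermal_evolution_def isothermal_curve_def int F_def G_def
        scaleR_add_right scaleR_diff_right)
  ultimately show ?thesis
    by blast
qed

lemma bounded_linear_characteristics:
  "bounded_linear (\<lambda>p::real^2. p $ 1 + p $ 2)" "bounded_linear (\<lambda>p::real^2. p $ 1 - p $ 2)"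
  by (intro bounded_linear_add bounded_linear_sub bounded_linear_vec_nth)+

lemma Ck_evolution: "Ck_open (Suc n) UNIV \<phi>"
proof -
  obtain F G where F: "\<And>x. (F has_vector_derivative A x) (at x)"
    and G: "\<And>x. (G has_vector_derivative B x) (at x)"
    and eq: "\<And>p. \<phi> p = spacetime (p $ 2) (F (p $ 1 + p $ 2) + G (p $ 1 - p $ 2))"
    using dalembert_form by blast
  have CF: "Ck_open (Suc n) UNIV F"
    using F Ck_A by (rule Ck_open_antiderivative)
  have CG: "Ck_open (Suc n) UNIV G"
    using G Ck_B by (rule Ck_open_antiderivative)
  \<comment> \<open>The evolution is split into a linear map and two functions of one variable with
    linear maps on either side, so closure under sums and linear maps suffices.\<close>
  have "Ck_open (Suc n) UNIV (\<lambda>p::real^2. (p $ 2) *\<^sub>R (spacetime 1 0))"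
    by (intro Ck_open_bounded_linear bounded_linear_scaleR_const bounded_linear_vec_nth)
  moreover have "Ck_open (Suc n) UNIV (\<lambda>p::real^2. spacetime 0 (F (p $ 1 + p $ 2)))"
    by (intro Ck_open_bounded_linear_left[OF bounded_linear_spacetime]
        Ck_open_bounded_linear_right[OF bounded_linear_characteristics(1), where f = F] CF)
  moreover have "Ck_open (Suc n) UNIV (\<lambda>p::real^2. spacetime 0 (G (p $ 1 - p $ 2)))"
    by (intro Ck_open_bounded_linear_left[OF bounded_linear_spacetime]
        Ck_open_bounded_linear_right[OF bounded_linear_characteristics(2), where f = G] CG)
  ultimately have "Ck_open (Suc n) UNIV (\<lambda>p::real^2. (p $ 2) *\<^sub>R (spacetime 1 0) +
      (spacetime 0 (F (p $ 1 + p $ 2)) + spacetime 0 (G (p $ 1 - p $ 2))))"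
    by (intro Ck_open_add)
  also have "(\<lambda>p::real^2. (p $ 2) *\<^sub>R (spacetime 1 0) +
      (spacetime 0 (F (p $ 1 + p $ 2)) + spacetime 0 (G (p $ 1 - p $ 2)))) = \<phi>"
    by (simp add: fun_eq_iff eq spacetime_add spacetime_scaleR)
  finally show ?thesis .
qed

section \<open>Derivative, induced metric and geometry of the evolution\<close>

lemma evolution_has_derivative:
  "(\<phi> has_derivative (\<lambda>u. spacetime (u $ 2) (u $ 1 *\<^sub>R \<gamma>_s p + u $ 2 *\<^sub>R \<gamma>_t p))) (at p)"
proof -
  obtain F G where F: "\<And>x. (F has_vector_derivative A x) (at x)"
    and G: "\<And>x. (G has_vector_derivative B x) (at x)"
    and eq: "\<And>p. \<phi> p = spacetime (p $ 2) (F (p $ 1 + p $ 2) + G (p $ 1 - p $ 2))"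
    using dalembert_form by blast
  note char = bounded_linear_characteristics[THEN bounded_linear_imp_has_derivative]
  have F': "((\<lambda>p. F (p $ 1 + p $ 2)) has_derivative (\<lambda>u. (u $ 1 + u $ 2) *\<^sub>R A (p $ 1 + p $ 2))) (at p)"
    using has_derivative_compose[OF char(1) F[unfolded has_vector_derivative_def]] .
  have G': "((\<lambda>p. G (p $ 1 - p $ 2)) has_derivative (\<lambda>u. (u $ 1 - u $ 2) *\<^sub>R B (p $ 1 - p $ 2))) (at p)"
    using has_derivative_compose[OF char(2) G[unfolded has_vector_derivative_def]] .
  have "((\<lambda>p. (p $ 2) *\<^sub>R (spacetime 1 0) + spacetime 0 (F (p $ 1 + p $ 2) + G (p $ 1 - p $ 2)))
      has_derivative (\<lambda>u. (u $ 2) *\<^sub>R (spacetime 1 0) +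
        spacetime 0 ((u $ 1 + u $ 2) *\<^sub>R A (p $ 1 + p $ 2) + (u $ 1 - u $ 2) *\<^sub>R B (p $ 1 - p $ 2)))) (at p)"
    by (intro has_derivative_add F' G' bounded_linear.has_derivative[OF bounded_linear_spacetime]
        bounded_linear_imp_has_derivative bounded_linear_scaleR_const bounded_linear_vec_nth)
  then show ?thesis
    unfolding eq[abs_def]
    by (simp add: spacetime_add spacetime_scaleR \<gamma>_s_def \<gamma>_t_def algebra_simps)
qed

lemma frechet_derivative_evolution:
  "frechet_derivative \<phi> (at p) = (\<lambda>u. spacetime (u $ 2) (u $ 1 *\<^sub>R \<gamma>_s p + u $ 2 *\<^sub>R \<gamma>_t p))"
  using frechet_derivative_at[OF evolution_has_derivative] by simp

lemma partial_deriv_evolution: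
  "partial_deriv 1 \<phi> p = spacetime 0 (\<gamma>_s p)" "partial_deriv 2 \<phi> p = spacetime 1 (\<gamma>_t p)"
  by (simp_all add: partial_deriv_def frechet_derivative_evolution axis_def)

lemma partial_deriv_evolution_nth:
  "partial_deriv i (\<lambda>q. \<phi> q $ \<alpha>) p = partial_deriv i \<phi> p $ \<alpha>"
proof -
  have "((\<lambda>q. \<phi> q $ \<alpha>) has_derivative (\<lambda>u. frechet_derivative \<phi> (at p) u $ \<alpha>)) (at p)"
    unfolding frechet_derivative_evolution
    by (rule bounded_linear.has_derivative[OF bounded_linear_vec_nth evolution_has_derivative])
  then show ?thesis
    unfolding partial_deriv_def by (metis frechet_derivative_at)
qed

text \<open>The mixed entry is (A + B).(A - B) = |A|^2 - |B|^2 = 0. As |A + B|^2 + |A - B|^2 =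
  2(|A|^2 + |B|^2) = 1, the tt entry |A - B|^2 - 1 equals -|A + B|^2.\<close>

lemma induced_form_evolution:
  "induced_form \<phi> p $ 1 $ 1 = (norm (\<gamma>_s p))\<^sup>2" "induced_form \<phi> p $ 2 $ 2 = - (norm (\<gamma>_s p))\<^sup>2"
  "induced_form \<phi> p $ 1 $ 2 = 0" "induced_form \<phi> p $ 2 $ 1 = 0"
  using inner_commute[of "B (p $ 1 - p $ 2)" "A (p $ 1 + p $ 2)"]
  by (simp_all add: induced_form_def partial_deriv_evolution minkowski_spacetime power2_norm_eq_inner
      \<gamma>_s_def \<gamma>_t_def inner_add_left inner_add_right inner_diff_left inner_diff_right norm_AB)

lemma det_induced_form_evolution: "det (induced_form \<phi> p) = - (norm (\<gamma>_s p) ^ 4)"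
  by (simp add: det_2 induced_form_evolution power2_eq_square power4_eq_xxxx)

lemma timelike_on_evolution:
  assumes "\<And>p. p \<in> S \<Longrightarrow> \<gamma>_s p \<noteq> 0"
  shows "timelike_on S \<phi>"
  using assms by (simp add: timelike_on_def det_induced_form_evolution)

text \<open>On a kernel vector the time component forces the t entry to vanish, and
  \<open>\<gamma>_s p \<noteq> 0\<close> then forces the s entry to vanish. Smoothness holds on the
  whole plane, which serves as the neighbourhood.\<close>

lemma immersion_evolution:
  assumes "\<And>p. p \<in> S \<Longrightarrow> \<gamma>_s p \<noteq> 0"
  shows "Ck_immersion_on (Suc n) S \<phi>"
proof -
  have "inj (frechet_derivative \<phi> (at p))" if "p \<in> S" for p
  proof -
    have "linear (frechet_derivative \<phi> (at p))"
      unfolding frechet_derivative_evolution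
      by (rule has_derivative_linear[OF evolution_has_derivative])
    then show ?thesis
      using assms[OF that]
      by (auto simp: linear_injective_0 frechet_derivative_evolution) (simp add: vec_eq_iff forall_2)
  qed
  moreover have "open UNIV \<and> S \<subseteq> UNIV \<and> Ck_open (Suc n) UNIV \<phi>"
    using Ck_evolution by blast
  ultimately show ?thesis
    unfolding Ck_immersion_on_def by blast
qed

text \<open>In null coordinates the wave operator is \<open>(\<partial>\<^sub>s + \<partial>\<^sub>t)(\<partial>\<^sub>s - \<partial>\<^sub>t)\<close>, and \<open>\<phi>\<^sub>s + \<phi>\<^sub>t\<close> is constant
  along \<open>\<partial>\<^sub>s - \<partial>\<^sub>t\<close> while \<open>\<phi>\<^sub>s - \<phi>\<^sub>t\<close> is constant along \<open>\<partial>\<^sub>s + \<partial>\<^sub>t\<close>.\<close>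

lemma weakly_maximal_on_evolution:
  assumes nz: "\<And>p. p \<in> S \<Longrightarrow> \<gamma>_s p \<noteq> 0"
  shows "weakly_maximal_on S \<phi>"
  unfolding weakly_maximal_on_def
proof (intro allI impI)
  fix \<psi> :: "real^2 \<Rightarrow> real" and \<alpha> :: 3
  assume test: "test_function_on (interior S) \<psi>"
  \<comment> \<open>\<open>?a\<close> and \<open>?b\<close> are the \<open>\<alpha>\<close>
    components of the null derivatives, the sum and the difference of the s and t derivatives of
    \<open>\<phi>\<close>.\<close>
  let ?a = "\<lambda>p::real^2. spacetime 1 (2 *\<^sub>R A (p $ 1 + p $ 2)) $ \<alpha>"
  let ?b = "\<lambda>p::real^2. spacetime (-1) (2 *\<^sub>R B (p $ 1 - p $ 2)) $ \<alpha>"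
  let ?D = "\<lambda>p. frechet_derivative \<psi> (at p)"
  let ?e = "axis 1 1 :: real^2" and ?f = "axis 2 1 :: real^2"
  let ?I = "\<lambda>p. (\<Sum>i\<in>UNIV. \<Sum>j\<in>UNIV.
           sqrt \<bar>det (induced_form \<phi> p)\<bar> * matrix_inv (induced_form \<phi> p) $ i $ j *
           partial_deriv j (\<lambda>q. \<phi> q $ \<alpha>) p * partial_deriv i \<psi> p)"
  have \<psi>: "Ck_open 1 UNIV \<psi>" and K: "compact (closure {p. \<psi> p \<noteq> 0})"
    and sub: "closure {p. \<psi> p \<noteq> 0} \<subseteq> interior S"
    using test unfolding test_function_on_def by blast+
  have sp: "spacetime t x = t *\<^sub>R spacetime 1 0 + spacetime 0 x" for t x
    by (simp add: spacetime_add spacetime_scaleR)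
  have cont: "continuous_on UNIV (\<lambda>p. spacetime t (2 *\<^sub>R f (L p)) $ \<alpha>)"
    if "Ck_open n UNIV f" "bounded_linear L" for t and f and L :: "real^2 \<Rightarrow> real"
  proof (subst sp, intro continuous_intros bounded_linear.continuous_on[OF bounded_linear_spacetime])
    show "continuous_on UNIV (\<lambda>p. f (L p))"
      by (rule Ck_open_imp_continuous_on[OF Ck_open_bounded_linear_right[OF that(2,1)]])
  qed
  have ca: "continuous_on UNIV ?a"
    by (rule cont[OF Ck_A bounded_linear_characteristics(1)])
  have cb: "continuous_on UNIV ?b"
    by (rule cont[OF Ck_B bounded_linear_characteristics(2)])
  have inva: "?a (p + r *\<^sub>R (?e - ?f)) = ?a p" and invb: "?b (p + r *\<^sub>R (?e + ?f)) = ?b p" for p r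
    by (simp_all add: axis_def)
  note a = integral_directional_derivative_eq_0[OF \<psi> K ca inva]
  note b = integral_directional_derivative_eq_0[OF \<psi> K cb invb]
  \<comment> \<open>This is the identity Px - Qy = (P + Q)(x - y)/2 + (P - Q)(x + y)/2, with P, Q
    the s and t derivatives of \<open>\<phi>\<close> and x, y those of \<open>\<psi>\<close>. Off
    the interior of \<open>S\<close> both sides vanish, so the integral may be taken over the whole
    plane, where translations act.\<close>
  have eq: "indicator (interior S) p *\<^sub>R ?I p
      = (1/2) * (?a p * ?D p (?e - ?f)) + (1/2) * (?b p * ?D p (?e + ?f))" for p
  proof (cases "p \<in> interior S")
    case True
    with interior_subset have "norm (\<gamma>_s p) ^ 2 > 0"
      using nz[of p] by auto
    note dens = conformal_densitised_inverse[OF this induced_form_evolution]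
    have lin: "linear (?D p)"
      using \<psi> by (auto intro!: linear_frechet_derivative)
    have "?I p = spacetime 0 (\<gamma>_s p) $ \<alpha> * ?D p ?e - spacetime 1 (\<gamma>_t p) $ \<alpha> * ?D p ?f"
      by (simp add: dens sum_2 partial_deriv_evolution_nth partial_deriv_evolution)
        (simp add: partial_deriv_def)
    also have "spacetime 0 (\<gamma>_s p) = (1/2) *\<^sub>R (spacetime 1 (2 *\<^sub>R A (p $ 1 + p $ 2)) + spacetime (-1) (2 *\<^sub>R B (p $ 1 - p $ 2)))"
      by (simp add: spacetime_add spacetime_scaleR \<gamma>_s_def scaleR_add_right)
    also have "spacetime 1 (\<gamma>_t p) = (1/2) *\<^sub>R (spacetime 1 (2 *\<^sub>R A (p $ 1 + p $ 2)) + (-1) *\<^sub>R spacetime (-1) (2 *\<^sub>R B (p $ 1 - p $ 2)))"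
      by (simp add: spacetime_add spacetime_scaleR \<gamma>_t_def scaleR_diff_right)
    finally show ?thesis
      using True by (simp add: linear_add[OF lin] linear_diff[OF lin] field_simps)
  next
    case False
    with sub have "?D p = (\<lambda>u. 0)"
      by (intro frechet_derivative_outside_support) blast
    with False show ?thesis by simp
  qed
  show "(LINT p:interior S|lborel. ?I p) = 0"
    unfolding set_lebesgue_integral_def eq using a b by simp
qed

section \<open>Initial conditions\<close>

lemma evolution_initial:
  "\<phi> (vector [s, 0]) = initial_curve c s"
  by (simp add: isothermal_evolution_def isothermal_curve_def initial_curve_def
      interval_integral_endpoints_same flip: scaleR_add_left)

text \<open>At t = 0 both waves have argument s, so \<open>\<gamma>_t\<close> is A(s) - B(s) = v(s),
  and the initial velocity is the image of the t direction.\<close>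

lemma initial_velocity_tangent:
  "initial_velocity v s \<in> tangent_plane \<phi> (vector [s, 0])"
proof -
  have "initial_velocity v s = frechet_derivative \<phi> (at (vector [s, 0])) (axis 2 1)"
    by (simp add: frechet_derivative_evolution initial_velocity_def \<gamma>_t_def A_def B_def axis_def
        flip: scaleR_diff_right)
  then show ?thesis
    unfolding tangent_plane_def by blast
qed

section \<open>Nondegeneracy from a speed bound and slow turning of the tangent\<close>

text \<open>Testing \<open>\<gamma>\<^sub>s\<close> against the unit tangent \<open>U(y)\<close>, \<open>y = s - t\<close>: the second wave contributes
  \<open>\<bar>c'(y)\<bar>/2 \<ge> \<delta>/2\<close>, and the first, with \<open>x = s + t\<close>, at least \<open>v(x) \<bullet> (U(y) - U(x))/2 > - \<delta>/2\<close>.\<close>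

lemma nondegenerate:
  assumes speed: "\<And>x. \<delta> \<le> norm (c' x)" and \<delta>: "0 < \<delta>"
    and close: "dist (unit_tangent c (p $ 1 + p $ 2)) (unit_tangent c (p $ 1 - p $ 2)) < \<delta>"
  shows "\<gamma>_s p \<noteq> 0"
proof -
  let ?U = "unit_tangent c"
  define x where "x = p $ 1 + p $ 2"
  define y where "y = p $ 1 - p $ 2"
  have pos: "norm (c' z) > 0" for z
    using \<delta> speed by (rule less_le_trans)
  have U1: "norm (?U z) = 1" for z
    using pos[of z] by (simp add: unit_tangent_def)
  have cU: "c' z = norm (c' z) *\<^sub>R ?U z" for z
    using pos[of z] by (simp add: unit_tangent_def)
  have vU: "v z \<bullet> ?U z = 0" for z
    using orthogonal[of z] by (simp add: unit_tangent_def inner_commute)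
  have d: "norm (?U x - ?U y) < \<delta>"
    using close by (simp add: dist_norm x_def y_def)
  \<comment> \<open>Unit vectors at distance below 1 have nonnegative inner product, so c'(x) cannot
    contribute negatively along \<open>?U y\<close>; only v(x) can.\<close>
  also have "\<delta> \<le> 1"
    using speed[of 0] norm_le_1[of 0] by linarith
  finally have "(norm (?U x - ?U y))\<^sup>2 < 1\<^sup>2"
    by (intro power_strict_mono) auto
  moreover have "(norm (?U x - ?U y))\<^sup>2 = 2 - 2 * (?U x \<bullet> ?U y)"
    using U1[of x] U1[of y] inner_commute[of "?U y" "?U x"]
    by (simp add: power2_norm_eq_inner inner_diff_left inner_diff_right norm_eq_1)
  ultimately have "0 \<le> ?U x \<bullet> ?U y"
    by simp
  then have 1: "0 \<le> c' x \<bullet> ?U y"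
    by (subst cU) (simp add: pos less_imp_le)
  have "\<bar>v x \<bullet> (?U x - ?U y)\<bar> \<le> norm (v x) * norm (?U x - ?U y)"
    by (rule Cauchy_Schwarz_ineq2)
  also have "\<dots> \<le> norm (?U x - ?U y)"
    using norm_le_1(2)[of x] by (simp add: mult_left_le_one_le)
  finally have 2: "- \<delta> < v x \<bullet> ?U y"
    using d vU[of x] by (simp add: inner_diff_right)
  have 3: "c' y \<bullet> ?U y = norm (c' y)"
    using U1[of y] by (subst cU) (simp add: norm_eq_1)
  have "2 * (\<gamma>_s p \<bullet> ?U y) = c' x \<bullet> ?U y + v x \<bullet> ?U y + c' y \<bullet> ?U y - v y \<bullet> ?U y"
    by (simp add: \<gamma>_s_def A_def B_def x_def y_def inner_add_left inner_diff_left field_simps)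
  with 1 2 3 vU[of y] speed[of y] have "\<gamma>_s p \<bullet> ?U y > 0"
    by simp
  then show ?thesis by auto
qed

text \<open>With M the supremum, 1/M is at most 1 - |v|, hence at most 1 - |v|^2 = |c'|^2, which is
  at most |c'| because |c'| is at most 1.\<close>

lemma norm_c'_lower_bound:
  assumes "(SUP s. norm (v s)) < 1"
  shows "(SUP s. 1 / (1 - norm (v s))) > 0"
    and "1 / (SUP s. 1 / (1 - norm (v s))) \<le> norm (c' x)"
proof -
  define M where "M = (SUP s. 1 / (1 - norm (v s)))"
  define l where "l = (SUP s. norm (v s))"
  have l: "norm (v s) \<le> l" for s
    unfolding l_def by (intro cSUP_upper bdd_aboveI2[of _ _ 1]) (auto intro: norm_le_1)
  have l1: "l < 1" using assms by (simp add: l_def)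
  have lt1: "norm (v s) < 1" for s
    using l[of s] l1 by simp
  \<comment> \<open>A real \<open>SUP\<close> is known to be an upper bound only for a bounded
    family; the uniform bound \<open>l\<close> below 1 provides this.\<close>
  have "1 / (1 - norm (v s)) \<le> 1 / (1 - l)" for s
    using l[of s] l1 by (intro divide_left_mono) auto
  then have M: "1 / (1 - norm (v s)) \<le> M" for s
    unfolding M_def by (intro cSUP_upper bdd_aboveI2) auto
  have "0 < 1 / (1 - norm (v x))"
    using lt1[of x] by simp
  with M[of x] have pos: "0 < M" by linarith
  then show "(SUP s. 1 / (1 - norm (v s))) > 0" by (simp add: M_def)
  have "1 / M \<le> 1 - norm (v x)"
    using M[of x] pos lt1[of x] by (simp add: field_simps)
  also have "\<dots> \<le> 1 - (norm (v x))\<^sup>2"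
    using norm_le_1(2)[of x] by (simp add: power2_eq_square mult_left_le_one_le)
  also have "\<dots> = (norm (c' x))\<^sup>2"
    using normalised[of x] by simp
  also have "\<dots> \<le> norm (c' x)"
    using norm_le_1(1)[of x] by (simp add: power2_eq_square mult_left_le_one_le)
  finally show "1 / (SUP s. 1 / (1 - norm (v s))) \<le> norm (c' x)"
    by (simp add: M_def)
qed

end

section \<open>Short-time existence\<close>

lemma dist_le_modulus_of_continuity:
  assumes "dist x y \<le> d" "modulus_of_continuity f d \<le> ennreal e" "0 \<le> e"
  shows "dist (f x) (f y) \<le> e"
proof -
  have "ennreal (dist (f x) (f y)) \<le> modulus_of_continuity f d"
    unfolding modulus_of_continuity_def using assms(1) by (intro SUP_upper2[of "(x, y)"]) auto
  with assms(2,3) show ?thesis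
    by (meson ennreal_le_iff order_trans)
qed

lemma uniformly_continuous_modulus_of_continuity:
  fixes f :: "'a::metric_space \<Rightarrow> 'b::metric_space"
  assumes "uniformly_continuous_on UNIV f" "0 < e"
  shows "\<exists>d>0. modulus_of_continuity f d \<le> ennreal e"
proof -
  obtain d where d: "d > 0" "\<And>x y. dist x y < d \<Longrightarrow> dist (f x) (f y) < e"
    using assms unfolding uniformly_continuous_on_def by (metis UNIV_I dist_commute)
  \<comment> \<open>Halving \<open>d\<close> passes from the strict distance condition of uniform
    continuity to the non-strict one in the modulus.\<close>
  have "modulus_of_continuity f (d / 2) \<le> ennreal e"
    unfolding modulus_of_continuity_def
  proof (rule SUP_least, clarify)
    fix x y :: 'a assume "dist x y \<le> d / 2"
    with d show "ennreal (dist (f x) (f y)) \<le> ennreal e"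
      by (intro ennreal_leI less_imp_le d(2)) simp
  qed
  with \<open>d > 0\<close> show ?thesis
    by (intro exI[of _ "d / 2"]) simp
qed

text \<open>Fixing \<open>M\<close> and \<open>\<omega>\<close> first and choosing \<open>T\<close>
  before the data expresses that \<open>T\<close> depends on these two quantities only.\<close>

theorem corollary5p12:
  fixes M :: real and \<omega> :: "real \<Rightarrow> ennreal"
  shows "\<exists>T>0. \<forall>(k::nat) (c :: real \<Rightarrow> real^2) (v :: real \<Rightarrow> real^2) (\<phi> :: real^2 \<Rightarrow> real^3) S \<Sigma>.
    k \<ge> 1 \<and> initial_data k c v \<and> \<phi> = isothermal_evolution c v \<and>
    (SUP s. norm (v s)) < 1 \<and> uniformly_continuous_on UNIV (unit_tangent c) \<and>
    (SUP s. 1 / (1 - norm (v s))) = M \<and> modulus_of_continuity (unit_tangent c) = \<omega> \<and>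
    S = {p. \<bar>p $ 2\<bar> \<le> T} \<and> \<Sigma> = range \<phi> \<inter> {x. \<bar>x $ 1\<bar> \<le> T} \<longrightarrow>
      \<Sigma> = \<phi> ` S \<and>
      Ck_immersion_on k S \<phi> \<and> timelike_on S \<phi> \<and> weakly_maximal_on S \<phi> \<and>
      range (initial_curve c) \<subseteq> \<Sigma> \<and>
      (\<forall>s. \<phi> (vector [s, 0]) = initial_curve c s \<and>
           initial_velocity v s \<in> tangent_plane \<phi> (vector [s, 0]))"
proof -
  \<comment> \<open>The points s + t and s - t are at most 2T apart, hence the argument
    \<open>2 * T\<close>. The threshold is half of the speed bound 1/M, so that a non-strict
    estimate still yields the strict one needed for nondegeneracy.\<close>
  obtain T where T: "T > 0"
    and \<omega>T: "(\<exists>d>0. \<omega> d \<le> ennreal (1 / (2 * M))) \<Longrightarrow> \<omega> (2 * T) \<le> ennreal (1 / (2 * M))"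
  proof (cases "\<exists>d>0. \<omega> d \<le> ennreal (1 / (2 * M))")
    case True
    then obtain d where "d > 0" "\<omega> d \<le> ennreal (1 / (2 * M))" by blast
    then show ?thesis using that[of "d / 2"] by simp
  next
    case False
    \<comment> \<open>No admissible data have these \<open>M\<close> and \<open>\<omega>\<close>,
      since uniform continuity would supply such a \<open>d\<close>; the value 1 is
      arbitrary.\<close>
    show ?thesis by (rule that[of 1]) (use False in auto)
  qed
  show ?thesis
  proof (intro exI[of _ T] conjI[OF T] allI impI, elim conjE)
    fix k :: nat and c v :: "real \<Rightarrow> real^2" and \<phi> :: "real^2 \<Rightarrow> real^3"
      and S :: "(real^2) set" and \<Sigma> :: "(real^3) set"
    assume k: "1 \<le> k" and data: "initial_data k c v" and \<phi>: "\<phi> = isothermal_evolution c v"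
      and lt: "(SUP s. norm (v s)) < 1" and uc: "uniformly_continuous_on UNIV (unit_tangent c)"
      and M: "(SUP s. 1 / (1 - norm (v s))) = M" and \<omega>: "modulus_of_continuity (unit_tangent c) = \<omega>"
      and S: "S = {p. \<bar>p $ 2\<bar> \<le> T}" and \<Sigma>: "\<Sigma> = range \<phi> \<inter> {x. \<bar>x $ 1\<bar> \<le> T}"
    obtain n where n: "k = Suc n" using k by (cases k) auto
    interpret isothermal_data n c v
      using data by unfold_locales (simp add: n)
    have Mpos: "M > 0" and speed: "\<And>x. 1 / M \<le> norm (c' x)"
      using norm_c'_lower_bound[OF lt] M by auto
    have \<omega>T': "modulus_of_continuity (unit_tangent c) (2 * T) \<le> ennreal (1 / (2 * M))"
      unfolding \<omega>
      by (rule \<omega>T) (use uniformly_continuous_modulus_of_continuity[OF uc] Mpos \<omega> in simp)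
    have nz: "\<gamma>_s p \<noteq> 0" if "p \<in> S" for p
    proof (rule nondegenerate[OF speed])
      have "dist (unit_tangent c (p $ 1 + p $ 2)) (unit_tangent c (p $ 1 - p $ 2)) \<le> 1 / (2 * M)"
        by (rule dist_le_modulus_of_continuity[OF _ \<omega>T'])
          (use that Mpos in \<open>auto simp: S dist_real_def\<close>)
      also have "\<dots> < 1 / M"
        using Mpos by (simp add: field_simps)
      finally show "dist (unit_tangent c (p $ 1 + p $ 2)) (unit_tangent c (p $ 1 - p $ 2)) < 1 / M" .
    qed (use Mpos in simp)
    \<comment> \<open>The time coordinate on the surface is the parameter t, so cutting the image at
      height \<open>T\<close> amounts to restricting to the strip.\<close>
    have time: "\<phi> p $ 1 = p $ 2" for p
      by (simp add: \<phi> isothermal_evolution_def)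
    have "\<Sigma> = \<phi> ` S"
      by (auto simp: \<Sigma> S time)
    moreover have "initial_curve c s \<in> \<Sigma>" for s
    proof -
      have "initial_curve c s \<in> range \<phi>"
        unfolding \<phi> evolution_initial[of s, symmetric] by (rule rangeI)
      with T show ?thesis
        by (simp add: \<Sigma> initial_curve_def)
    qed
    ultimately show "\<Sigma> = \<phi> ` S \<and>
      Ck_immersion_on k S \<phi> \<and> timelike_on S \<phi> \<and> weakly_maximal_on S \<phi> \<and>
      range (initial_curve c) \<subseteq> \<Sigma> \<and>
      (\<forall>s. \<phi> (vector [s, 0]) = initial_curve c s \<and>
           initial_velocity v s \<in> tangent_plane \<phi> (vector [s, 0]))"
      using immersion_evolution[OF nz] timelike_on_evolution[OF nz]
        weakly_maximal_on_evolution[OF nz] evolution_initial initial_velocity_tangent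
      by (auto simp: n \<phi>)
  qed
qed

end
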